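(* Let $\langle f,g\rangle=\int_{-\infty}^{+\infty} f(x)g(x)e^{-x^2}\,dx$ on real polynomials. Let $h_0,h_1,h_2,\dots$ be the orthogonal sequence produced by the Gram-Schmidt process (without normalization) from the monomials $1,x,x^2,\dots$ with respect to this inner product. Then for every integer $n\ge 0$, $$h_n(x)=\sum_{m=0}^{\lfloor n/2\rfloor}\frac{(-1)^m\,n!}{2^n\,m!\,(n-2m)!}(2x)^{n-2m}=\frac{n!}{2^n}H_n(x).$$
   Context: The Gram-Schmidt process applied to linearly independent vectors $v_0,v_1,\dots$ produces $u_k=v_k-\sum_{i=0}^{k-1}\frac{\langle v_k,u_i\rangle}{\langle u_i,u_i\rangle}u_i$ for $k\ge 0$ (so $u_0=v_0$, and the coefficient of $v_k$ in $u_k$ is $1$). The Hermite polynomials are here defined (with this particular normalization) by $$H_n(x)=\sum_{m=0}^{\lfloor n/2\rfloor}\frac{(-1)^m}{m!\,(n-2m)!}(2x)^{n-2m}.$$ *)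

theory Defs
  imports "HOL-Analysis.Analysis" "HOL-Computational_Algebra.Polynomial"
begin

text \<open>The product of a polynomial with the Gaussian weight is Lebesgue integrable, so the
  convention that the Bochner integral of a non-integrable function is 0 plays no role here.\<close>

definition gauss_inner :: "real poly \<Rightarrow> real poly \<Rightarrow> real" where
  "gauss_inner f g = (LINT x|lborel. poly f x * poly g x * exp (- (x ^ 2)))"

fun gram_schmidt ::
  "(real poly \<Rightarrow> real poly \<Rightarrow> real) \<Rightarrow> (nat \<Rightarrow> real poly) \<Rightarrow> nat \<Rightarrow> real poly" where
  "gram_schmidt ip v k =
     v k - (\<Sum>i<k. smult (ip (v k) (gram_schmidt ip v i) /
                           ip (gram_schmidt ip v i) (gram_schmidt ip v i))
                          (gram_schmidt ip v i))"

text \<open>The defining equation is recursive without a constructor pattern; as a rewrite rule it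
  would loop.\<close>

declare gram_schmidt.simps [simp del]

text \<open>The normalization differs by a factor of \<open>n!\<close> from the usual physicists' Hermite
  polynomials; \<open>[:0, 2:]\<close> is the polynomial \<open>2x\<close>.\<close>

definition hermite :: "nat \<Rightarrow> real poly" where
  "hermite n = (\<Sum>m = 0..n div 2.
     smult ((-1) ^ m / (fact m * fact (n - 2 * m))) ([:0, 2:] ^ (n - 2 * m)))"

end

theory Submission
  imports Defs "HOL-Probability.Distributions"
begin

text \<open>
  Write \<open>H\<^sub>n\<close> for \<open>hermite n\<close> and \<open>G\<close> for the linear functional sending a polynomial \<open>p\<close> to the
  integral of \<open>p(x) exp(-x^2)\<close>.  The proof characterises the orthogonalised monomials as the only
  monic orthogonal sequence of polynomials in which the \<open>n\<close>-th one has degree \<open>n\<close>, and checks that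
  \<open>(n!/2^n) H\<^sub>n\<close> is such a sequence (\<open>gram_schmidt_unique\<close>, \<open>poly_span_graded_sequence\<close>).

  Since \<open>(p(x) exp(-x^2))' = (p'(x) - 2x p(x)) exp(-x^2)\<close>, the functional satisfies
  \<open>G(p') = G(2x p)\<close> (\<open>gauss_integral_pderiv\<close>).  On the algebraic side
  \<open>(n+1) H\<^sub>n\<^sub>+\<^sub>1 = 2x H\<^sub>n - H\<^sub>n'\<close> (\<open>hermite_Suc\<close>), so that
  \<open>(n+1) G(H\<^sub>n\<^sub>+\<^sub>1 f) = G((H\<^sub>n f)' - H\<^sub>n' f) = G(H\<^sub>n f')\<close>: up to a scalar, raising the index of the
  Hermite polynomial is adjoint to differentiation (\<open>gauss_inner_hermite_Suc\<close>).
  Applying this \<open>n\<close> times shows that \<open>H\<^sub>n\<close> is orthogonal to every polynomial of degree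
  below \<open>n\<close>; with \<open>H\<^sub>n\<^sub>+\<^sub>1' = 2 H\<^sub>n\<close> the same identity yields the positivity of the norms.
\<close>

section \<open>Uniqueness of the Gram-Schmidt sequence\<close>

text \<open>The projection coefficients of \<open>v k\<close> are forced: pairing \<open>v k = p k + (\<Sum>i<k. c i p i)\<close> with
  \<open>p j\<close> leaves only \<open>c j\<close> times \<open>ip (p j) (p j)\<close>.\<close>

lemma gram_schmidt_unique:
  assumes add: "\<And>f g h. ip (f + g) h = ip f h + ip g h"
    and smult: "\<And>c f h. ip (smult c f) h = c * ip f h"
    and orth: "\<And>i j. i \<noteq> j \<Longrightarrow> ip (p i) (p j) = 0"
    and nz: "\<And>i. ip (p i) (p i) \<noteq> 0"
    and v: "\<And>k. \<exists>c. v k = p k + (\<Sum>i<k. smult (c i) (p i))"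
  shows "gram_schmidt ip v k = p k"
proof (induction k rule: less_induct)
  case (less k)
  obtain c where c: "v k = p k + (\<Sum>i<k. smult (c i) (p i))"
    using v by blast
  have zero: "ip 0 h = 0" for h
    using smult[of 0 0 h] by simp
  have sum: "ip (sum f A) h = (\<Sum>i\<in>A. ip (f i) h)" if "finite A" for f :: "nat \<Rightarrow> real poly" and A h
    using that by (induction A rule: finite_induct) (simp_all add: add zero)
  have coef: "ip (v k) (p j) = c j * ip (p j) (p j)" if "j < k" for j
  proof -
    have "ip (v k) (p j) = (\<Sum>i<k. c i * ip (p i) (p j))"
      using that by (simp add: c add sum smult orth)
    also have "\<dots> = (\<Sum>i<k. if i = j then c j * ip (p j) (p j) else 0)"
      by (intro sum.cong) (auto simp: orth)
    finally show ?thesis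
      using that by simp
  qed
  have "gram_schmidt ip v k = v k - (\<Sum>i<k. smult (ip (v k) (p i) / ip (p i) (p i)) (p i))"
    by (subst gram_schmidt.simps) (simp add: less.IH)
  also have "\<dots> = v k - (\<Sum>i<k. smult (c i) (p i))"
    by (simp add: coef nz)
  finally show ?case
    by (simp add: c)
qed

text \<open>A sequence with exactly one polynomial in each degree is a triangular basis: cancelling the
  leading coefficient lowers the degree.\<close>

lemma poly_span_graded_sequence:
  fixes p :: "nat \<Rightarrow> 'a :: field poly"
  assumes deg: "\<And>i. degree (p i) = i" and nz: "\<And>i. p i \<noteq> 0"
    and f: "\<And>i. i \<ge> k \<Longrightarrow> coeff f i = 0"
  shows "\<exists>c. f = (\<Sum>i<k. smult (c i) (p i))"
  using f
proof (induction k arbitrary: f)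
  case 0
  then show ?case
    by (auto simp: poly_eq_iff)
next
  case (Suc k)
  define a where "a = coeff f k / coeff (p k) k"
  have lead: "coeff (p k) k \<noteq> 0"
    using nz[of k] deg[of k] leading_coeff_0_iff[of "p k"] by simp
  have "coeff (f - smult a (p k)) i = 0" if "i \<ge> k" for i
  proof (cases "i = k")
    case True
    then show ?thesis
      using lead by (simp add: a_def)
  next
    case False
    then show ?thesis
      using that Suc.prems[of i] by (simp add: coeff_eq_0 deg)
  qed
  from Suc.IH[OF this] obtain c where c: "f - smult a (p k) = (\<Sum>i<k. smult (c i) (p i))"
    by blast
  have "f = (\<Sum>i<Suc k. smult ((c(k := a)) i) (p i))"
    using c by (simp add: algebra_simps)
  then show ?case
    by blast
qed

section \<open>Integration against the Gaussian weight\<close>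

definition gauss_integral :: "real poly \<Rightarrow> real" where
  "gauss_integral p = (LINT x|lborel. poly p x * exp (- (x ^ 2)))"

lemma gauss_inner_eq: "gauss_inner f g = gauss_integral (f * g)"
  by (simp add: gauss_inner_def gauss_integral_def)

lemma has_gauss_moment_even:
  "has_bochner_integral lborel (\<lambda>x. exp (- (x ^ 2)) * x ^ (2 * k) :: real)
     (sqrt pi * (fact (2 * k) / (2 ^ (2 * k) * fact k)))"
  using has_bochner_integral_even_function[OF gaussian_moment_even_pos[where k = k]] by simp

lemma has_gauss_moment_odd:
  "has_bochner_integral lborel (\<lambda>x. exp (- (x ^ 2)) * x ^ (2 * k + 1) :: real) 0"
  using gaussian_moment_odd_pos by (rule has_bochner_integral_odd_function) simp

lemma integrable_gauss_moment: "integrable lborel (\<lambda>x. exp (- (x ^ 2)) * x ^ k :: real)"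
proof (cases "even k")
  case True
  then obtain j where "k = 2 * j"
    by (elim evenE)
  then show ?thesis
    using has_gauss_moment_even[of j] by (simp only: integrable.intros)
next
  case False
  then obtain j where "k = 2 * j + 1"
    by (elim oddE)
  then show ?thesis
    using has_gauss_moment_odd[of j] by (simp only: integrable.intros)
qed

lemma integrable_gauss_poly: "integrable lborel (\<lambda>x. poly p x * exp (- (x ^ 2)) :: real)"
proof -
  have "integrable lborel (\<lambda>x. \<Sum>i\<le>degree p. coeff p i * (exp (- (x ^ 2)) * x ^ i) :: real)"
    by (intro Bochner_Integration.integrable_sum integrable_mult_right integrable_gauss_moment)
  then show ?thesis
    by (simp add: poly_altdef sum_distrib_left sum_distrib_right mult_ac)
qed

lemma gauss_integral_add: "gauss_integral (p + q) = gauss_integral p + gauss_integral q"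
  by (simp add: gauss_integral_def distrib_right integrable_gauss_poly)

lemma gauss_integral_smult: "gauss_integral (smult c p) = c * gauss_integral p"
  by (simp add: gauss_integral_def mult.assoc)

lemma gauss_integral_diff: "gauss_integral (p - q) = gauss_integral p - gauss_integral q"
  by (simp add: gauss_integral_def left_diff_distrib integrable_gauss_poly)

lemma gauss_integral_monom_even:
  "gauss_integral (monom a (2 * k)) = a * (sqrt pi * (fact (2 * k) / (2 ^ (2 * k) * fact k)))"
  using has_bochner_integral_integral_eq[OF has_gauss_moment_even[of k]]
  by (simp add: gauss_integral_def poly_monom mult_ac)

lemma gauss_integral_monom_odd: "gauss_integral (monom a (2 * k + 1)) = 0"
  using has_bochner_integral_integral_eq[OF has_gauss_moment_odd[of k]]
    gauss_integral_smult[of a "monom 1 (2 * k + 1)"]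
  by (simp add: gauss_integral_def poly_monom smult_monom mult_ac)

lemma gauss_integral_1: "gauss_integral 1 = sqrt pi"
  using gauss_integral_monom_even[of 1 0] by simp

text \<open>Integration by parts without a boundary term.  By linearity it suffices to treat monomials,
  where it is the recurrence between consecutive Gaussian moments of the same parity.\<close>

lemma gauss_integral_pderiv: "gauss_integral (pderiv p) = gauss_integral ([:0, 2:] * p)"
proof -
  have monom: "gauss_integral (pderiv (monom a k)) = gauss_integral ([:0, 2:] * monom a k)"
    for a :: real and k
  proof -
    have times: "[:0, 2:] * monom a k = monom (2 * a) (Suc k)"
      by (simp add: monom_Suc smult_monom)
    show ?thesis
    proof (cases "even k")
      case True
      then obtain j where j: "k = 2 * j"
        by (elim evenE)
      show ?thesis
      proof (cases j)
        case 0
        then show ?thesis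
          using gauss_integral_monom_odd[of "2 * a" 0] j times
          by (simp add: pderiv_monom gauss_integral_def)
      next
        case (Suc i)
        then show ?thesis
          using gauss_integral_monom_odd[of "2 * a" j] gauss_integral_monom_odd[of "of_nat k * a" i]
            j times
          by (simp add: pderiv_monom)
      qed
    next
      case False
      then obtain j where j: "k = 2 * j + 1"
        by (elim oddE)
      have "gauss_integral (monom (2 * a) (2 * Suc j)) =
              gauss_integral (monom (of_nat (2 * j + 1) * a) (2 * j))"
        unfolding gauss_integral_monom_even by (simp add: divide_simps)
      then show ?thesis
        using j times by (simp add: pderiv_monom)
    qed
  qed
  have sum: "gauss_integral (sum f A) = (\<Sum>i\<in>A. gauss_integral (f i))" if "finite A"
    for f :: "nat \<Rightarrow> real poly" and A
    using that
    by (induction A rule: finite_induct)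
       (simp_all add: gauss_integral_add gauss_integral_def[of 0])
  have pderiv_sum: "pderiv (sum f A) = (\<Sum>i\<in>A. pderiv (f i))"
    for f :: "nat \<Rightarrow> real poly" and A
    using higher_pderiv_sum[of 1 f A] by simp
  have "gauss_integral (pderiv (\<Sum>i\<le>degree p. monom (coeff p i) i)) =
          gauss_integral ([:0, 2:] * (\<Sum>i\<le>degree p. monom (coeff p i) i))"
    by (simp only: pderiv_sum sum_distrib_left sum monom finite_atMost)
  then show ?thesis
    by (simp only: poly_as_sum_of_monoms)
qed

section \<open>Hermite polynomials\<close>

lemma linear_monom_power: "[:0, 2 :: real:] ^ k = monom (2 ^ k) k"
  by (induction k) (simp_all add: monom_Suc smult_monom)

lemma coeff_hermite:
  "coeff (hermite n) k =
     (if k \<le> n \<and> even (n - k)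
      then (-1) ^ ((n - k) div 2) * 2 ^ k / (fact ((n - k) div 2) * fact k) else 0)"
proof -
  have *: "coeff (hermite n) k =
          (\<Sum>m = 0..n div 2. if n - 2 * m = k
             then (-1) ^ m * 2 ^ k / (fact m * fact k) else 0)"
    unfolding hermite_def coeff_sum
    by (intro sum.cong refl) (auto simp: linear_monom_power)
  show ?thesis
  proof (cases "k \<le> n \<and> even (n - k)")
    case True
    then obtain j where j: "n = k + 2 * j"
      by (metis dvdE le_add_diff_inverse)
    have "coeff (hermite n) k =
            (\<Sum>m = 0..n div 2. if m = j then (-1) ^ j * 2 ^ k / (fact j * fact k) else 0)"
      unfolding * using j by (intro sum.cong refl) auto
    then show ?thesis
      using j by simp
  next
    case False
    have "n - 2 * m \<noteq> k" if "m \<le> n div 2" for m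
      using False that by auto
    then show ?thesis
      using False unfolding * by (auto intro!: sum.neutral)
  qed
qed

lemma hermite_0: "hermite 0 = 1"
  by (simp add: hermite_def)

lemma pderiv_hermite_Suc: "pderiv (hermite (Suc n)) = smult 2 (hermite n)"
  by (rule poly_eqI) (auto simp: coeff_pderiv coeff_hermite divide_simps)

text \<open>The shape that the three-term recurrence takes once the polynomial of index \<open>n - 1\<close> is
  expressed through the derivative of \<open>H\<^sub>n\<close>; this is the form that integration by parts can use.\<close>

lemma hermite_Suc:
  "smult (of_nat (Suc n)) (hermite (Suc n)) = [:0, 2:] * hermite n - pderiv (hermite n)"
proof (rule poly_eqI)
  fix k
  have shift: "coeff ([:0, 2:] * hermite n) k = (case k of 0 \<Rightarrow> 0 | Suc j \<Rightarrow> 2 * coeff (hermite n) j)"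
    by (simp add: coeff_pCons split: nat.split)
  consider (out) "\<not> (k \<le> Suc n \<and> even (Suc n - k))" | (top) "k = Suc n"
    | (inner) m where "n = k + 2 * m + 1"
  proof (cases "k \<le> n \<and> even (Suc n - k)")
    case True
    then obtain j where "Suc n - k = 2 * j"
      by (elim conjE evenE)
    with True have "n = k + 2 * (j - 1) + 1"
      by auto
    then show ?thesis
      by (rule that(3))
  next
    case False
    then show ?thesis
      using that(1,2) by (cases "k = Suc n") auto
  qed
  then show "coeff (smult (of_nat (Suc n)) (hermite (Suc n))) k =
               coeff ([:0, 2:] * hermite n - pderiv (hermite n)) k"
  proof cases
    case out
    then have "coeff (hermite n) (Suc k) = 0" "\<And>j. k = Suc j \<Longrightarrow> coeff (hermite n) j = 0"
      by (auto simp: coeff_hermite)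
    with out show ?thesis
      by (auto simp: shift coeff_pderiv coeff_hermite[of "Suc n"] split: nat.split
               simp del: mult_pCons_left)
  next
    case top
    have "coeff ([:0, 2:] * hermite n) (Suc n) = 2 * coeff (hermite n) n"
      by simp
    then show ?thesis
      using top by (simp add: coeff_pderiv coeff_hermite divide_simps del: mult_pCons_left)
  next
    case inner
    define a :: real where "a = (-1) ^ m * 2 ^ k / (fact m * fact k)"
    have 1: "coeff (hermite (Suc n)) k = - a / of_nat (Suc m)"
      using inner by (simp add: coeff_hermite a_def divide_simps)
    have 2: "coeff (hermite n) (Suc k) = 2 * a / of_nat (Suc k)"
      using inner by (simp add: coeff_hermite a_def divide_simps)
    have 3: "(case k of 0 \<Rightarrow> 0 | Suc j \<Rightarrow> 2 * coeff (hermite n) j) = - a * of_nat k / of_nat (Suc m)"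
      using inner by (cases k) (simp_all add: coeff_hermite a_def divide_simps)
    have "coeff ([:0, 2:] * hermite n - pderiv (hermite n)) k =
            - a * of_nat k / of_nat (Suc m) - of_nat (Suc k) * (2 * a / of_nat (Suc k))"
      by (simp only: coeff_diff shift coeff_pderiv 2 3)
    also have "\<dots> = of_nat (Suc n) * (- a / of_nat (Suc m))"
      using inner by (simp add: divide_simps) (simp add: algebra_simps)
    finally show ?thesis
      by (simp only: coeff_smult 1)
  qed
qed

section \<open>Orthogonality\<close>

lemma gauss_inner_hermite_Suc:
  "of_nat (Suc n) * gauss_inner (hermite (Suc n)) f = gauss_inner (hermite n) (pderiv f)"
proof -
  have "of_nat (Suc n) * gauss_inner (hermite (Suc n)) f =
          gauss_integral (([:0, 2:] * hermite n - pderiv (hermite n)) * f)"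
    by (simp only: gauss_inner_eq flip: gauss_integral_smult mult_smult_left hermite_Suc)
  also have "\<dots> = gauss_integral (pderiv (hermite n * f)) - gauss_integral (pderiv (hermite n) * f)"
    by (simp only: left_diff_distrib gauss_integral_diff gauss_integral_pderiv mult.assoc)
  also have "\<dots> = gauss_inner (hermite n) (pderiv f)"
    by (simp only: gauss_inner_eq pderiv_mult gauss_integral_add) (simp add: mult.commute)
  finally show ?thesis .
qed

lemma gauss_inner_hermite_degree_less:
  assumes "degree f < n"
  shows "gauss_inner (hermite n) f = 0"
  using assms
proof (induction n arbitrary: f)
  case 0
  then show ?case
    by simp
next
  case (Suc n)
  have "gauss_inner (hermite n) (pderiv f) = 0"
  proof (cases "degree f = 0")
    case True
    then have "pderiv f = 0"
      by (simp add: pderiv_eq_0_iff)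
    then show ?thesis
      by (simp add: gauss_inner_def)
  next
    case False
    then show ?thesis
      using Suc by (intro Suc.IH) (simp add: degree_pderiv)
  qed
  then show ?case
    using gauss_inner_hermite_Suc[of n f] by simp
qed

lemma gauss_inner_hermite_self_pos: "gauss_inner (hermite n) (hermite n) > 0"
proof (induction n)
  case 0
  then show ?case
    by (simp add: gauss_inner_eq hermite_0 gauss_integral_1)
next
  case (Suc n)
  have "of_nat (Suc n) * gauss_inner (hermite (Suc n)) (hermite (Suc n)) =
          2 * gauss_inner (hermite n) (hermite n)"
    unfolding gauss_inner_hermite_Suc pderiv_hermite_Suc
    by (simp add: gauss_inner_eq gauss_integral_smult)
  then have "of_nat (Suc n) * gauss_inner (hermite (Suc n)) (hermite (Suc n)) > 0"
    using Suc by simp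
  then show ?case
    by (simp add: zero_less_mult_iff)
qed

lemma degree_hermite: "degree (hermite n) = n"
proof (rule antisym)
  show "degree (hermite n) \<le> n"
    by (rule degree_le) (simp add: coeff_hermite)
  show "n \<le> degree (hermite n)"
    by (rule le_degree) (simp add: coeff_hermite)
qed

lemma gauss_inner_hermite_orthogonal:
  assumes "i \<noteq> j"
  shows "gauss_inner (hermite i) (hermite j) = 0"
proof (cases "j < i")
  case True
  then show ?thesis
    by (simp add: gauss_inner_hermite_degree_less degree_hermite)
next
  case False
  then have "gauss_inner (hermite j) (hermite i) = 0"
    using assms by (simp add: gauss_inner_hermite_degree_less degree_hermite)
  then show ?thesis
    by (simp add: gauss_inner_eq mult.commute)
qed

section \<open>Orthogonalising the monomials\<close>

text \<open>The leading coefficient of \<open>H\<^sub>n\<close> is \<open>2^n/n!\<close>, whose inverse is the scaling factor that makes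
  the polynomial monic, as the orthogonalisation of the monomials requires.\<close>

lemma gram_schmidt_monom_gauss:
  "gram_schmidt gauss_inner (\<lambda>k. monom 1 k) n = smult (fact n / 2 ^ n) (hermite n)"
proof -
  define p where "p n = smult (fact n / 2 ^ n) (hermite n)" for n
  have deg: "degree (p i) = i" for i
    by (simp add: p_def degree_hermite)
  have monic: "coeff (p i) i = 1" for i
    by (simp add: p_def coeff_hermite)
  have inner_p: "gauss_inner (p i) (p j) =
      fact i / 2 ^ i * (fact j / 2 ^ j) * gauss_inner (hermite i) (hermite j)" for i j
    by (simp only: p_def gauss_inner_eq mult_smult_left mult_smult_right gauss_integral_smult
        mult_ac)
  have "gram_schmidt gauss_inner (\<lambda>k. monom 1 k) n = p n"
  proof (rule gram_schmidt_unique)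
    show "gauss_inner (f + g) h = gauss_inner f h + gauss_inner g h" for f g h
      by (simp add: gauss_inner_eq distrib_right gauss_integral_add)
    show "gauss_inner (smult c f) h = c * gauss_inner f h" for c f h
      by (simp add: gauss_inner_eq gauss_integral_smult)
    show "gauss_inner (p i) (p j) = 0" if "i \<noteq> j" for i j
      using that by (simp add: inner_p gauss_inner_hermite_orthogonal)
    show "gauss_inner (p i) (p i) \<noteq> 0" for i
      using gauss_inner_hermite_self_pos[of i] by (simp add: inner_p)
    show "\<exists>c. monom 1 k = p k + (\<Sum>i<k. smult (c i) (p i))" for k
    proof -
      have "coeff (monom 1 k - p k) i = 0" if "i \<ge> k" for i
        using that monic by (cases "i = k") (simp_all add: coeff_eq_0 deg)
      moreover have "p i \<noteq> 0" for i
        using monic[of i] by auto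
      ultimately obtain c where "monom 1 k - p k = (\<Sum>i<k. smult (c i) (p i))"
        using poly_span_graded_sequence[of p k "monom 1 k - p k"] deg by blast
      then show ?thesis
        by (metis add.commute diff_add_cancel)
    qed
  qed
  then show ?thesis
    by (simp add: p_def)
qed

theorem mainTheorem3:
  fixes n :: nat and x :: real
  defines "h \<equiv> gram_schmidt gauss_inner (\<lambda>k. monom 1 k)"
  shows "poly (h n) x =
           (\<Sum>m = 0..n div 2.
              (-1) ^ m * fact n / (2 ^ n * fact m * fact (n - 2 * m)) * (2 * x) ^ (n - 2 * m)) \<and>
         (\<Sum>m = 0..n div 2.
              (-1) ^ m * fact n / (2 ^ n * fact m * fact (n - 2 * m)) * (2 * x) ^ (n - 2 * m)) =
           fact n / 2 ^ n * poly (hermite n) x"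
proof -
  have "fact n / 2 ^ n * poly (hermite n) x =
      (\<Sum>m = 0..n div 2.
         (-1) ^ m * fact n / (2 ^ n * fact m * fact (n - 2 * m)) * (2 * x) ^ (n - 2 * m))"
    unfolding hermite_def poly_sum sum_distrib_left
    by (intro sum.cong refl) (simp add: mult_ac)
  then show ?thesis
    by (simp add: h_def gram_schmidt_monom_gauss)
qed

end
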